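(* Let $(G,X)$ be a self-similar group, $|X|=d\ge 2$, let $\mu=\sum_{g\in G}\mu_g g\in\ell^1(G)$ be a probability distribution on $G$, and let $i\in X$. Let $H=\mathrm{St}_G(i)$ be the stabilizer of $i$ in $G$, let $\mu_H$ be the distribution on $H$ of the first hit of $H$ (at a time $n\ge 1$) by the left random walk on $G$ generated by $\mu$ and started at the identity, and let $\mu_i$ be the image of $\mu_H$ under the map $p_i:H\to G$, $p_i(h)=h|_i$. Then \[\mu_i=k_i(\mu),\] where $k_i$ is the $i$th probabilistic Schur map.
   Context: Let $X$ be a finite alphabet and $X^*$ the rooted tree of finite words over $X$. A self-similar group $(G,X)$ is a group $G$ acting faithfully on the rooted tree $X^*$ such that for every $g\in G$, $x\in X$ there are $h\in G$, $y\in X$ with $g(xw)=yh(w)$ for all $w\in X^*$; then $y=g(x)$ and $h$ is denoted $g|_x$. The left random walk on $G$ generated by $\mu$ makes, at each step, the move $g\mapsto hg$ with probability $\mu_h$ (steps independent). Thus $\mu_H(h)=\sum_{n\ge 1}f^{(n)}_{e,h}$, where $f^{(n)}_{e,h}$ is the probability that the walk started at the identity $e$ visits $H$ at a time $\geq 1$ for the first time at step $n$ and at the element $h$. Probabilistic Schur map: the matrix of $\mu$ is $M=(m_{yx})_{x,y\in X}$ with entries $m_{yx}=\sum_{g\in G,\ g(x)=y}\mu_g\, g|_x\in\ell^1(G)$. Let $M_{i\bar i}=(m_{ij})_{j\neq i}$ be the $i$th row with $m_{ii}$ deleted, $M_{\bar i i}=(m_{ji})_{j\ne i}$ the $i$th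 column with $m_{ii}$ deleted, and $M_{\bar i\bar i}$ the $(d-1)\times(d-1)$ matrix obtained from $M$ by removing its $i$th row and column. Then \[k_i(\mu)=m_{ii}+M_{i\bar i}\,(I-M_{\bar i\bar i})^{-1}M_{\bar i i},\] where $(I-M_{\bar i\bar i})^{-1}$ is understood as the series $I+M_{\bar i\bar i}+M_{\bar i\bar i}^2+\cdots$, i.e. $k_i(\mu)=m_{ii}+\sum_{n\ge 0}M_{i\bar i}M_{\bar i\bar i}^nM_{\bar i i}$ with convergence in $\ell^1(G)$; products are convolution products in $\ell^1(G)$. (Equivalently, $k_i=JS_iJ^{-1}$, where $S_i$ is the $i$th Schur complement $m_{ii}-M_{i\bar i}M_{\bar i\bar i}^{-1}M_{\bar i i}$ and $J(A)=A+I$.) *)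

theory Defs
  imports "HOL-Algebra.Group_Action" "HOL-Probability.Probability"
begin

section \<open>Self-similar groups\<close>

text \<open>The children of a word \<open>w\<close> in the rooted tree are the words \<open>w @ [x]\<close>.\<close>

definition rooted_tree_automorphism :: "'x set \<Rightarrow> ('x list \<Rightarrow> 'x list) \<Rightarrow> bool" where
  "rooted_tree_automorphism X t \<longleftrightarrow>
     bij_betw t (lists X) (lists X) \<and> t [] = [] \<and>
     (\<forall>w\<in>lists X. \<forall>x\<in>X. \<exists>y\<in>X. t (w @ [x]) = t w @ [y])"

locale self_similar_group = faithful_action G "lists X" \<phi>
  for G :: "('g, 'm) monoid_scheme" (structure)
    and X :: "'x set"
    and \<phi> :: "'g \<Rightarrow> 'x list \<Rightarrow> 'x list" +
  assumes finite_alphabet: "finite X"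
    and tree_automorphism: "g \<in> carrier G \<Longrightarrow> rooted_tree_automorphism X (\<phi> g)"
    and self_similar:
      "\<lbrakk>g \<in> carrier G; x \<in> X\<rbrakk> \<Longrightarrow>
         \<exists>h\<in>carrier G. \<exists>y\<in>X. \<forall>w\<in>lists X. \<phi> g (x # w) = y # \<phi> h w"

text \<open>The restriction \<open>g|\<^sub>x\<close>; it is unique because the action is faithful.\<close>

definition restr ::
  "('g, 'm) monoid_scheme \<Rightarrow> 'x set \<Rightarrow> ('g \<Rightarrow> 'x list \<Rightarrow> 'x list) \<Rightarrow> 'g \<Rightarrow> 'x \<Rightarrow> 'g" where
  "restr G X \<phi> g x =
     (THE h. h \<in> carrier G \<and> (\<exists>y\<in>X. \<forall>w\<in>lists X. \<phi> g (x # w) = y # \<phi> h w))"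


section \<open>The Banach algebra of absolutely summable functions on a group\<close>

text \<open>Elements vanish outside the carrier, so that equality in the algebra is equality of
  functions.\<close>

definition l1 :: "('g, 'm) monoid_scheme \<Rightarrow> ('g \<Rightarrow> real) set" where
  "l1 G = {a. (\<lambda>g. \<bar>a g\<bar>) summable_on carrier G \<and> (\<forall>g. g \<notin> carrier G \<longrightarrow> a g = 0)}"

definition l1_norm :: "('g, 'm) monoid_scheme \<Rightarrow> ('g \<Rightarrow> real) \<Rightarrow> real" where
  "l1_norm G a = (\<Sum>\<^sub>\<infinity>g\<in>carrier G. \<bar>a g\<bar>)"

definition l1_conv ::
  "('g, 'm) monoid_scheme \<Rightarrow> ('g \<Rightarrow> real) \<Rightarrow> ('g \<Rightarrow> real) \<Rightarrow> 'g \<Rightarrow> real" where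
  "l1_conv G a b = (\<lambda>h. \<Sum>\<^sub>\<infinity>(p, q)\<in>{(p, q) \<in> carrier G \<times> carrier G. p \<otimes>\<^bsub>G\<^esub> q = h}. a p * b q)"

definition l1_one :: "('g, 'm) monoid_scheme \<Rightarrow> 'g \<Rightarrow> real" where
  "l1_one G = (\<lambda>h. if h = \<one>\<^bsub>G\<^esub> then 1 else 0)"

definition l1_sums ::
  "('g, 'm) monoid_scheme \<Rightarrow> (nat \<Rightarrow> 'g \<Rightarrow> real) \<Rightarrow> ('g \<Rightarrow> real) \<Rightarrow> bool" where
  "l1_sums G f s \<longleftrightarrow>
     (\<forall>n. f n \<in> l1 G) \<and> s \<in> l1 G \<and>
     (\<lambda>N. l1_norm G (\<lambda>g. (\<Sum>n<N. f n g) - s g)) \<longlonglongrightarrow> 0"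

definition l1_summable :: "('g, 'm) monoid_scheme \<Rightarrow> (nat \<Rightarrow> 'g \<Rightarrow> real) \<Rightarrow> bool" where
  "l1_summable G f \<longleftrightarrow> (\<exists>s. l1_sums G f s)"

definition l1_suminf :: "('g, 'm) monoid_scheme \<Rightarrow> (nat \<Rightarrow> 'g \<Rightarrow> real) \<Rightarrow> 'g \<Rightarrow> real" where
  "l1_suminf G f = (THE s. l1_sums G f s)"


section \<open>The probabilistic Schur maps\<close>

text \<open>The entry \<open>m\<^sub>y\<^sub>x\<close> of the matrix of \<open>a\<close>, the sum of \<open>a g \<cdot> g|\<^sub>x\<close> over all \<open>g\<close> with
  \<open>g(x) = y\<close>: its coefficient at \<open>h\<close> collects the \<open>g\<close> with \<open>g|\<^sub>x = h\<close>.\<close>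

definition mat_entry ::
  "('g, 'm) monoid_scheme \<Rightarrow> 'x set \<Rightarrow> ('g \<Rightarrow> 'x list \<Rightarrow> 'x list) \<Rightarrow> ('g \<Rightarrow> real) \<Rightarrow>
     'x \<Rightarrow> 'x \<Rightarrow> 'g \<Rightarrow> real" where
  "mat_entry G X \<phi> a y x =
     (\<lambda>h. \<Sum>\<^sub>\<infinity>g\<in>{g \<in> carrier G. \<phi> g [x] = [y] \<and> restr G X \<phi> g x = h}. a g)"

text \<open>Matrices with rows and columns indexed by a finite set \<open>J\<close> are functions of two indices,
  only the values on \<open>J\<close> being relevant.\<close>

definition mat_prod ::
  "('g, 'm) monoid_scheme \<Rightarrow> 'x set \<Rightarrow> ('x \<Rightarrow> 'x \<Rightarrow> 'g \<Rightarrow> real) \<Rightarrow> ('x \<Rightarrow> 'x \<Rightarrow> 'g \<Rightarrow> real) \<Rightarrow>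
     'x \<Rightarrow> 'x \<Rightarrow> 'g \<Rightarrow> real" where
  "mat_prod G J A B y x = (\<lambda>h. \<Sum>z\<in>J. l1_conv G (A y z) (B z x) h)"

primrec mat_power ::
  "('g, 'm) monoid_scheme \<Rightarrow> 'x set \<Rightarrow> ('x \<Rightarrow> 'x \<Rightarrow> 'g \<Rightarrow> real) \<Rightarrow> nat \<Rightarrow>
     'x \<Rightarrow> 'x \<Rightarrow> 'g \<Rightarrow> real" where
  "mat_power G J A 0 = (\<lambda>y x. if y = x then l1_one G else (\<lambda>h. 0))"
| "mat_power G J A (Suc n) = mat_prod G J A (mat_power G J A n)"

text \<open>The product (row \<open>i\<close> without \<open>m\<^sub>i\<^sub>i\<close>) \<open>\<cdot>\<close> (\<open>n\<close>-th power of the matrix with row and column \<open>i\<close>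
  removed) \<open>\<cdot>\<close> (column \<open>i\<close> without \<open>m\<^sub>i\<^sub>i\<close>).\<close>

definition schur_term ::
  "('g, 'm) monoid_scheme \<Rightarrow> 'x set \<Rightarrow> ('g \<Rightarrow> 'x list \<Rightarrow> 'x list) \<Rightarrow> 'x \<Rightarrow> ('g \<Rightarrow> real) \<Rightarrow>
     nat \<Rightarrow> 'g \<Rightarrow> real" where
  "schur_term G X \<phi> i a n =
     (let M = mat_entry G X \<phi> a; J = X - {i}
      in mat_prod G J (mat_prod G J M (mat_power G J M n)) M i i)"

definition prob_schur_map ::
  "('g, 'm) monoid_scheme \<Rightarrow> 'x set \<Rightarrow> ('g \<Rightarrow> 'x list \<Rightarrow> 'x list) \<Rightarrow> 'x \<Rightarrow> ('g \<Rightarrow> real) \<Rightarrow>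
     'g \<Rightarrow> real" where
  "prob_schur_map G X \<phi> i a =
     (\<lambda>h. mat_entry G X \<phi> a i i h + l1_suminf G (schur_term G X \<phi> i a) h)"


section \<open>First hits of the left random walk\<close>

text \<open>Position of the left walk started at the identity after the successive increments
  \<open>h\<^sub>1, \<dots>, h\<^sub>n\<close>, i.e. \<open>h\<^sub>n \<cdots> h\<^sub>1\<close>.\<close>

definition left_walk :: "('g, 'm) monoid_scheme \<Rightarrow> 'g list \<Rightarrow> 'g" where
  "left_walk G hs = fold (\<lambda>h g. h \<otimes>\<^bsub>G\<^esub> g) hs \<one>\<^bsub>G\<^esub>"

text \<open>The probability that the walk visits \<open>H\<close> at a time \<open>\<ge> 1\<close> for the first time at step \<open>n\<close> and
  at the element \<open>h\<close>. This event depends on the first \<open>n\<close> increments only, and their joint law is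
  \<open>replicate_pmf n \<mu>\<close>.\<close>

definition first_hit_prob ::
  "('g, 'm) monoid_scheme \<Rightarrow> 'g pmf \<Rightarrow> 'g set \<Rightarrow> nat \<Rightarrow> 'g \<Rightarrow> real" where
  "first_hit_prob G \<mu> H n h =
     measure_pmf.prob (replicate_pmf n \<mu>)
       {hs. left_walk G hs = h \<and> h \<in> H \<and> (\<forall>k. 1 \<le> k \<and> k < n \<longrightarrow> left_walk G (take k hs) \<notin> H)}"

definition hitting_distribution ::
  "('g, 'm) monoid_scheme \<Rightarrow> 'g pmf \<Rightarrow> 'g set \<Rightarrow> 'g \<Rightarrow> real" where
  "hitting_distribution G \<mu> H h = (\<Sum>\<^sub>\<infinity>n\<in>{1..}. first_hit_prob G \<mu> H n h)"

definition image_distribution :: "('g \<Rightarrow> 'k) \<Rightarrow> 'g set \<Rightarrow> ('g \<Rightarrow> real) \<Rightarrow> 'k \<Rightarrow> real" where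
  "image_distribution p H \<nu> = (\<lambda>g. \<Sum>\<^sub>\<infinity>h\<in>{h \<in> H. p h = g}. \<nu> h)"

end

theory Submission
  imports Defs
begin

text \<open>Follow the letter \<open>i\<close> along the walk \<open>g\<^sub>n = h\<^sub>n \<cdots> h\<^sub>1\<close>: put \<open>x\<^sub>0 = i\<close> and
  \<open>x\<^sub>k = h\<^sub>k(x\<^sub>k\<^sub>-\<^sub>1)\<close>. The walk is in \<open>H\<close> at time \<open>k\<close> iff \<open>x\<^sub>k = i\<close>, and
  \<open>g\<^sub>n|\<^sub>i = h\<^sub>n|\<^bsub>x\<^sub>n\<^sub>-\<^sub>1\<^esub> \<cdots> h\<^sub>1|\<^bsub>x\<^sub>0\<^esub>\<close> because restriction is a cocycle. By independence of the
  increments, a product of entries of \<open>M\<close> along a letter path is therefore the law of the restriction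
  on the event that the letter follows that path. The paths that leave \<open>i\<close> and return for the first
  time at step \<open>1\<close> account for \<open>m\<^sub>i\<^sub>i\<close>, those that return first at step \<open>n + 2\<close> for the \<open>n\<close>-th
  term of the Schur series. First-return events are disjoint, so the norms of these nonnegative terms
  add up to at most \<open>1\<close>, which gives both the convergence in \<open>\<ell>\<^sup>1(G)\<close> and the exchange of sums.\<close>

section \<open>Fibres, independence and first passages for discrete distributions\<close>

lemma prob_cong_set_pmf:
  assumes "\<And>x. x \<in> set_pmf p \<Longrightarrow> x \<in> A \<longleftrightarrow> x \<in> B"
  shows "measure_pmf.prob p A = measure_pmf.prob p B"
  by (rule measure_prob_cong_0) (use assms in \<open>auto simp: set_pmf_iff\<close>)

lemma pmf_has_sum_prob: "(pmf p has_sum measure_pmf.prob p E) E"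
proof -
  have "pmf p summable_on E"
    using pmf_abs_summable[of p E] abs_summable_equivalent abs_summable_summable by blast
  moreover have "infsum (pmf p) E = measure_pmf.prob p E"
    by (simp add: measure_pmf_conv_infsetsum infsetsum_infsum pmf_abs_summable)
  ultimately show ?thesis
    by (simp add: has_sum_iff)
qed

text \<open>The atoms of \<open>p\<close> are regrouped by the value of \<open>f\<close>, so
  \<open>S\<close> may be uncountable. The laws handled below are such families of fibre
  probabilities.\<close>

lemma prob_fibres_has_sum:
  "((\<lambda>x. measure_pmf.prob p {a \<in> E. f a = x}) has_sum measure_pmf.prob p {a \<in> E. f a \<in> S}) S"
proof (rule has_sum_SigmaD)
  have "bij_betw snd (Sigma S (\<lambda>x. {a \<in> E. f a = x})) {a \<in> E. f a \<in> S}"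
    by (rule bij_betwI[where g = "\<lambda>a. (f a, a)"]) auto
  from has_sum_reindex_bij_betw[OF this, of "pmf p"]
  show "((\<lambda>(x, a). pmf p a) has_sum measure_pmf.prob p {a \<in> E. f a \<in> S})
          (Sigma S (\<lambda>x. {a \<in> E. f a = x}))"
    by (simp add: case_prod_unfold pmf_has_sum_prob)
qed (simp add: pmf_has_sum_prob)

lemma prob_pair_pmf_Times:
  "measure_pmf.prob (pair_pmf p q) (A \<times> B) = measure_pmf.prob p A * measure_pmf.prob q B"
proof -
  \<comment> \<open>Cutting down to the supports makes both factors countable, as
    \<open>measure_pmf_prob_product\<close> requires.\<close>
  have "measure_pmf.prob (pair_pmf p q) (A \<times> B)
      = measure_pmf.prob (pair_pmf p q) ((A \<inter> set_pmf p) \<times> (B \<inter> set_pmf q))"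
    by (rule prob_cong_set_pmf) auto
  then show ?thesis
    by (simp add: measure_pmf_prob_product measure_Int_set_pmf)
qed

text \<open>The tail comes first in the pair because later increments multiply on the left;
  \<open>replicate_pmf_Suc_snoc\<close> puts the last increment first for the same reason. Both
  orders then match the factors of a convolution.\<close>

lemma replicate_pmf_Suc_Cons:
  "replicate_pmf (Suc n) p = map_pmf (\<lambda>(xs, x). x # xs) (pair_pmf (replicate_pmf n p) p)"
proof -
  have "replicate_pmf (Suc n) p = map_pmf (\<lambda>(x, xs). x # xs) (pair_pmf p (replicate_pmf n p))"
    by (simp add: pair_pmf_def map_bind_pmf map_pmf_def bind_assoc_pmf bind_return_pmf)
  also have "pair_pmf p (replicate_pmf n p) = map_pmf (\<lambda>(x, y). (y, x)) (pair_pmf (replicate_pmf n p) p)"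
    by (rule pair_commute_pmf)
  finally show ?thesis
    by (simp add: map_pmf_comp case_prod_unfold)
qed

lemma replicate_pmf_Suc_snoc:
  "replicate_pmf (Suc n) p = map_pmf (\<lambda>(x, xs). xs @ [x]) (pair_pmf p (replicate_pmf n p))"
proof -
  have "replicate_pmf (Suc n) p
      = map_pmf (\<lambda>(xs, x). xs @ [x]) (pair_pmf (replicate_pmf n p) p)"
    using replicate_pmf_distrib[of n 1 p] unfolding replicate_pmf_1
    by (simp add: pair_pmf_def map_pmf_def bind_assoc_pmf bind_return_pmf del: replicate_pmf.simps)
  also have "pair_pmf (replicate_pmf n p) p = map_pmf (\<lambda>(x, y). (y, x)) (pair_pmf p (replicate_pmf n p))"
    by (rule pair_commute_pmf)
  finally show ?thesis
    by (simp add: map_pmf_comp case_prod_unfold)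
qed

lemma first_passage_summable:
  fixes Q :: "'a list \<Rightarrow> bool"
  shows "summable (\<lambda>m. measure_pmf.prob (replicate_pmf (Suc m) p)
           {xs. Q xs \<and> (\<forall>k. 1 \<le> k \<and> k \<le> m \<longrightarrow> \<not> Q (take k xs))})"
    (is "summable ?t")
proof (rule summableI_nonneg_bounded)
  fix N
  \<comment> \<open>The probability of no passage up to time \<open>m\<close>; its decrements are the terms of the series.\<close>
  define r where "r m = measure_pmf.prob (replicate_pmf m p)
    {xs. \<forall>k. 1 \<le> k \<and> k \<le> m \<longrightarrow> \<not> Q (take k xs)}" for m
  have step: "?t m + r (Suc m) = r m" for m
  proof -
    let ?S = "{xs. \<forall>k. 1 \<le> k \<and> k \<le> m \<longrightarrow> \<not> Q (take k xs)}"
    have "r (Suc m) = measure_pmf.prob (replicate_pmf (Suc m) p) (?S \<inter> {xs. \<not> Q xs})"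
      unfolding r_def
      by (rule prob_cong_set_pmf) (auto simp: set_replicate_pmf le_Suc_eq)
    moreover have "?t m = measure_pmf.prob (replicate_pmf (Suc m) p) (?S \<inter> {xs. Q xs})"
      by (rule arg_cong[where f = "measure_pmf.prob _"]) auto
    ultimately have "?t m + r (Suc m) = measure_pmf.prob (replicate_pmf (Suc m) p)
        ((?S \<inter> {xs. Q xs}) \<union> (?S \<inter> {xs. \<not> Q xs}))"
      by (subst measure_pmf.finite_measure_Union) auto
    also have "(?S \<inter> {xs. Q xs}) \<union> (?S \<inter> {xs. \<not> Q xs}) = ?S"
      by auto
    also have "measure_pmf.prob (replicate_pmf (Suc m) p) ?S
        = measure_pmf.prob (pair_pmf p (replicate_pmf m p)) (snd -` ?S)"
      unfolding replicate_pmf_Suc_snoc measure_map_pmf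
      by (rule prob_cong_set_pmf) (auto simp: set_replicate_pmf)
    also have "\<dots> = r m"
      unfolding r_def by (subst (2) map_snd_pair_pmf[of p, symmetric]) (simp add: measure_map_pmf)
    finally show ?thesis .
  qed
  have "(\<Sum>m<N. ?t m) + r N = r 0"
  proof (induction N)
    case (Suc N)
    then show ?case
      using step[of N] by simp
  qed simp
  moreover have "r 0 \<le> 1" "r N \<ge> 0"
    by (simp_all add: r_def)
  ultimately show "(\<Sum>m<N. ?t m) \<le> 1"
    by linarith
qed simp

section \<open>Series and convolutions of summable functions on the group\<close>

lemma has_sum_diff:
  fixes f g :: "'a \<Rightarrow> real"
  assumes "(f has_sum a) A" "(g has_sum b) A"
  shows "((\<lambda>x. f x - g x) has_sum (a - b)) A"
  using has_sum_add[OF assms(1) has_sum_uminusI[OF assms(2)]] by simp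

lemma has_sum_sum_lessThan:
  fixes f :: "nat \<Rightarrow> 'a \<Rightarrow> 'b::topological_comm_monoid_add"
  assumes "\<And>n. (f n has_sum t n) A"
  shows "((\<lambda>x. \<Sum>n<N. f n x) has_sum (\<Sum>n<N. t n)) A"
  by (induction N) (auto intro: has_sum_add assms)

text \<open>Norm convergence forces pointwise convergence on the carrier, and members of
  \<open>l1 G\<close> vanish elsewhere. This makes the definite description in
  \<open>l1_suminf\<close> proper.\<close>

lemma l1_sums_unique:
  assumes "l1_sums G f s" "l1_sums G f s'"
  shows "s = s'"
proof -
  have lim: "(\<lambda>N. \<Sum>n<N. f n g) \<longlonglongrightarrow> u g" if u: "l1_sums G f u" and g: "g \<in> carrier G" for u g
  proof -
    have le: "\<bar>(\<Sum>n<N. f n g) - u g\<bar> \<le> l1_norm G (\<lambda>g. (\<Sum>n<N. f n g) - u g)" for N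
    proof -
      \<comment> \<open>Summability comes first: \<open>infsum\<close> is 0 on a non-summable
        family, and a single value could then exceed \<open>l1_norm\<close>.\<close>
      have "f n summable_on carrier G" "u summable_on carrier G" for n
        using u by (auto simp: l1_sums_def l1_def intro: summable_on_iff_abs_summable_on_real[THEN iffD2])
      then have "(f n has_sum infsum (f n) (carrier G)) (carrier G)"
        "(u has_sum infsum u (carrier G)) (carrier G)" for n
        by (auto intro: has_sum_infsum)
      then have "(\<lambda>g. (\<Sum>n<N. f n g) - u g) summable_on carrier G"
        by (rule has_sum_imp_summable[OF has_sum_diff[OF has_sum_sum_lessThan]])
      then have "(\<lambda>g. \<bar>(\<Sum>n<N. f n g) - u g\<bar>) summable_on carrier G"
        using summable_on_iff_abs_summable_on_real[THEN iffD1] by fastforce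
      then show ?thesis
        using finite_sum_le_infsum[of "\<lambda>g. \<bar>(\<Sum>n<N. f n g) - u g\<bar>" "carrier G" "{g}"] g
        by (simp add: l1_norm_def)
    qed
    have "(\<lambda>N. \<bar>(\<Sum>n<N. f n g) - u g\<bar>) \<longlonglongrightarrow> 0"
    proof (rule tendsto_sandwich[where f = "\<lambda>_. 0"])
      show "(\<lambda>N. l1_norm G (\<lambda>g. (\<Sum>n<N. f n g) - u g)) \<longlonglongrightarrow> 0"
        using u by (simp add: l1_sums_def)
    qed (use le in auto)
    then show ?thesis
      using LIM_zero_cancel tendsto_rabs_zero_iff by blast
  qed
  show ?thesis
  proof
    fix g
    show "s g = s' g"
    proof (cases "g \<in> carrier G")
      case True
      then show ?thesis
        using lim assms LIMSEQ_unique by blast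
    next
      case False
      then show ?thesis
        using assms by (simp add: l1_sums_def l1_def)
    qed
  qed
qed

lemma l1_suminf_eq: "l1_sums G f s \<Longrightarrow> l1_suminf G f = s"
  unfolding l1_suminf_def by (rule the_equality) (auto dest: l1_sums_unique)

text \<open>Nonnegativity allows summing over all pairs \<open>(n, g)\<close> in either order. Hence
  the pointwise sum has finite norm \<open>suminf t\<close>, and the error norm after
  \<open>N\<close> terms is exactly the tail of \<open>t\<close>.\<close>

lemma nonneg_l1_sums:
  assumes nonneg: "\<And>n g. 0 \<le> f n g"
    and outside: "\<And>n g. g \<notin> carrier G \<Longrightarrow> f n g = 0"
    and norm: "\<And>n. (f n has_sum t n) (carrier G)"
    and "summable t"
  shows "l1_sums G f (\<lambda>g. \<Sum>n. f n g)"
proof -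
  define s where "s g = (\<Sum>n. f n g)" for g
  have t_nonneg: "0 \<le> t n" for n
    using norm nonneg by (rule has_sum_nonneg)
  then have t: "(t has_sum suminf t) UNIV"
    using assms(4) by (intro sums_nonneg_imp_has_sum) (auto intro: summable_sums)
  have "(\<lambda>(n, g). f n g) summable_on (UNIV \<times> carrier G)"
    by (rule summable_on_SigmaI[where g = t])
       (use norm nonneg t has_sum_imp_summable in auto)
  then have F: "((\<lambda>(n, g). f n g) has_sum suminf t) (UNIV \<times> carrier G)"
    by (intro has_sum_SigmaI[where g = t]) (use norm t in auto)
  then have F': "((\<lambda>(g, n). f n g) has_sum suminf t) (carrier G \<times> UNIV)"
    by (subst (asm) has_sum_swap) (simp add: case_prod_unfold)
  have fg: "(\<lambda>n. f n g) summable_on UNIV" if "g \<in> carrier G" for g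
    using summable_on_SigmaD1[of "\<lambda>g n. f n g" "carrier G" "\<lambda>_. UNIV" g] F' that
    by (simp add: has_sum_imp_summable)
  then have sg: "((\<lambda>n. f n g) has_sum s g) UNIV" if "g \<in> carrier G" for g
    unfolding s_def using that nonneg
    by (metis has_sum_imp_sums has_sum_infsum sums_unique)
  have s: "(s has_sum suminf t) (carrier G)"
    by (rule has_sum_SigmaD[OF F']) (simp add: sg)
  have partial: "(\<Sum>n<N. f n g) \<le> s g" if "g \<in> carrier G" for g N
    using finite_sum_le_has_sum[OF sg[OF that]] nonneg by simp
  have "((\<lambda>g. s g - (\<Sum>n<N. f n g)) has_sum (suminf t - (\<Sum>n<N. t n))) (carrier G)" for N
    by (intro has_sum_diff s has_sum_sum_lessThan norm)
  then have "((\<lambda>g. \<bar>(\<Sum>n<N. f n g) - s g\<bar>) has_sum (suminf t - (\<Sum>n<N. t n))) (carrier G)" for N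
    by (rule has_sum_cong[THEN iffD1, rotated]) (use partial in fastforce)
  then have "l1_norm G (\<lambda>g. (\<Sum>n<N. f n g) - s g) = suminf t - (\<Sum>n<N. t n)" for N
    unfolding l1_norm_def by (rule infsumI)
  moreover have "(\<lambda>N. suminf t - (\<Sum>n<N. t n)) \<longlonglongrightarrow> suminf t - suminf t"
    by (intro tendsto_diff tendsto_const summable_LIMSEQ assms(4))
  moreover have "f n \<in> l1 G" for n
    using norm[of n] nonneg outside by (auto simp: l1_def has_sum_imp_summable)
  moreover have "s \<in> l1 G"
  proof -
    have "0 \<le> s g" if "g \<in> carrier G" for g
      using partial[OF that, of 0] by simp
    then have "(\<lambda>g. \<bar>s g\<bar>) summable_on carrier G \<longleftrightarrow> s summable_on carrier G"
      by (intro summable_on_cong) simp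
    then show ?thesis
      using s outside by (simp add: l1_def has_sum_imp_summable s_def)
  qed
  ultimately have "l1_sums G f s"
    by (simp add: l1_sums_def)
  then show ?thesis
    by (simp add: s_def[abs_def])
qed

text \<open>Convolution gives the law of a product of independent factors. Here the left factor
  \<open>u z\<close> and its event \<open>A z\<close> depend on the state \<open>z = k b\<close>
  read off the other sample; summing over \<open>z\<close> in \<open>J\<close> joins these disjoint
  cases. Appending and prepending a step of the walk are both instances.\<close>

lemma sum_l1_conv_prob:
  assumes "finite J"
    and u: "\<And>z a. z \<in> J \<Longrightarrow> a \<in> A z \<Longrightarrow> u z a \<in> carrier G"
    and v: "\<And>b. b \<in> B \<Longrightarrow> v b \<in> carrier G"
  shows "(\<Sum>z\<in>J. l1_conv G (\<lambda>r. measure_pmf.prob p {a \<in> A z. u z a = r})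
                          (\<lambda>r. measure_pmf.prob q {b \<in> B. k b = z \<and> v b = r}) h)
    = measure_pmf.prob (pair_pmf p q)
        {(a, b). b \<in> B \<and> k b \<in> J \<and> a \<in> A (k b) \<and> u (k b) a \<otimes>\<^bsub>G\<^esub> v b = h}" (is "_ = ?R")
proof -
  have conv: "l1_conv G (\<lambda>r. measure_pmf.prob p {a \<in> A z. u z a = r})
                 (\<lambda>r. measure_pmf.prob q {b \<in> B. k b = z \<and> v b = r}) h
      = measure_pmf.prob (pair_pmf p q)
          {x \<in> {(a, b). b \<in> B \<and> a \<in> A (k b) \<and> u (k b) a \<otimes>\<^bsub>G\<^esub> v b = h}. k (snd x) = z}"
    if "z \<in> J" for z
  proof -
    let ?S = "{(r, r') \<in> carrier G \<times> carrier G. r \<otimes>\<^bsub>G\<^esub> r' = h}"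
    let ?E = "A z \<times> {b \<in> B. k b = z}"
    have "measure_pmf.prob p {a \<in> A z. u z a = r} * measure_pmf.prob q {b \<in> B. k b = z \<and> v b = r'}
        = measure_pmf.prob (pair_pmf p q) {x \<in> ?E. map_prod (u z) v x = (r, r')}" for r r'
      by (subst prob_pair_pmf_Times[symmetric])
         (auto intro!: arg_cong[where f = "measure_pmf.prob _"])
    then have "l1_conv G (\<lambda>r. measure_pmf.prob p {a \<in> A z. u z a = r})
                 (\<lambda>r. measure_pmf.prob q {b \<in> B. k b = z \<and> v b = r}) h
        = infsum (\<lambda>s. measure_pmf.prob (pair_pmf p q) {x \<in> ?E. map_prod (u z) v x = s}) ?S"
      by (simp add: l1_conv_def case_prod_unfold)
    also have "\<dots> = measure_pmf.prob (pair_pmf p q) {x \<in> ?E. map_prod (u z) v x \<in> ?S}"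
      by (rule infsumI) (rule prob_fibres_has_sum)
    also have "{x \<in> ?E. map_prod (u z) v x \<in> ?S}
        = {x \<in> {(a, b). b \<in> B \<and> a \<in> A (k b) \<and> u (k b) a \<otimes>\<^bsub>G\<^esub> v b = h}. k (snd x) = z}"
      using u[OF that] v by auto
    finally show ?thesis .
  qed
  have "(\<Sum>z\<in>J. measure_pmf.prob (pair_pmf p q)
          {x \<in> {(a, b). b \<in> B \<and> a \<in> A (k b) \<and> u (k b) a \<otimes>\<^bsub>G\<^esub> v b = h}. k (snd x) = z})
      = measure_pmf.prob (pair_pmf p q)
          {x \<in> {(a, b). b \<in> B \<and> a \<in> A (k b) \<and> u (k b) a \<otimes>\<^bsub>G\<^esub> v b = h}. k (snd x) \<in> J}"
    by (rule has_sum_unique[OF has_sum_finite[OF assms(1)] prob_fibres_has_sum])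
  also have "\<dots> = ?R"
    by (rule arg_cong[where f = "measure_pmf.prob _"]) auto
  finally show ?thesis
    using conv by simp
qed


section \<open>Letters and restrictions in a self-similar group\<close>

context self_similar_group
begin

text \<open>The action on the first level, read on letters instead of one-letter words; meaningful
  for \<open>g\<close> in the carrier and \<open>x\<close> in \<open>X\<close>.\<close>

definition letter :: "'g \<Rightarrow> 'x \<Rightarrow> 'x" where
  "letter g x = hd (\<phi> g [x])"

abbreviation restriction :: "'g \<Rightarrow> 'x \<Rightarrow> 'g" where
  "restriction \<equiv> restr G X \<phi>"

lemma is_group: "group G"
  using group_hom group_hom.axioms(1) by blast

lemma act_Nil: "g \<in> carrier G \<Longrightarrow> \<phi> g [] = []"
  using tree_automorphism by (simp add: rooted_tree_automorphism_def)

lemma eq_if_action_eq: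
  assumes "g \<in> carrier G" "h \<in> carrier G" "\<And>w. w \<in> lists X \<Longrightarrow> \<phi> g w = \<phi> h w"
  shows "g = h"
proof -
  \<comment> \<open>Members of \<open>Bij\<close> are \<open>undefined\<close> off
    \<open>lists X\<close>, so agreement on words is already equality of functions, to which
    faithfulness applies.\<close>
  have "\<phi> g \<in> extensional (lists X)" "\<phi> h \<in> extensional (lists X)"
    using assms bij_prop0 by (auto simp: Bij_def)
  then have "\<phi> g = \<phi> h"
    using assms(3) by (intro extensionalityI)
  then show ?thesis
    using faithful assms by (auto dest: inj_onD)
qed

text \<open>The empty word determines the letter, and faithfulness determines the restriction; this
  evaluates the definite description in \<open>restr\<close>.\<close>

lemma restriction_letter_unique:
  assumes "g \<in> carrier G" "x \<in> X" "h \<in> carrier G" "\<And>w. w \<in> lists X \<Longrightarrow> \<phi> g (x # w) = y # \<phi> h w"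
  shows "letter g x = y" "restriction g x = h"
proof -
  show y: "letter g x = y"
    using assms(4)[of "[]"] by (simp add: letter_def)
  have "y \<in> X"
    using element_image[OF assms(1), of "[x]"] assms(2,3) assms(4)[of "[]"] by simp
  then show "restriction g x = h"
    unfolding restr_def
  proof (intro the_equality conjI bexI[of _ y] ballI)
    fix k
    assume k: "k \<in> carrier G \<and> (\<exists>y\<in>X. \<forall>w\<in>lists X. \<phi> g (x # w) = y # \<phi> k w)"
    then have "\<phi> k w = \<phi> h w" if "w \<in> lists X" for w
      using assms(4)[OF that] that by (metis list.inject)
    then show "k = h"
      using k assms(3) by (intro eq_if_action_eq) auto
  qed (use assms in auto)
qed

lemma restriction_letter:
  assumes "g \<in> carrier G" "x \<in> X"
  shows "restriction g x \<in> carrier G" "letter g x \<in> X"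
    and "w \<in> lists X \<Longrightarrow> \<phi> g (x # w) = letter g x # \<phi> (restriction g x) w"
proof -
  obtain h y where h: "h \<in> carrier G" "y \<in> X" "\<forall>w\<in>lists X. \<phi> g (x # w) = y # \<phi> h w"
    using self_similar[OF assms] by blast
  with restriction_letter_unique[OF assms, of h y]
  show "restriction g x \<in> carrier G" "letter g x \<in> X"
    "w \<in> lists X \<Longrightarrow> \<phi> g (x # w) = letter g x # \<phi> (restriction g x) w"
    by auto
qed

lemma act_singleton: "g \<in> carrier G \<Longrightarrow> x \<in> X \<Longrightarrow> \<phi> g [x] = [letter g x]"
  using restriction_letter(1)[of g x] restriction_letter(3)[of g x "[]"] by (simp add: act_Nil)

text \<open>On \<open>x # w\<close> the factor \<open>h\<close> acts first and hands the letter
  \<open>letter h x\<close> to \<open>g\<close>; uniqueness then reads off both cocycle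
  identities.\<close>

lemma restriction_mult:
  assumes "g \<in> carrier G" "h \<in> carrier G" "x \<in> X"
  shows "letter (g \<otimes> h) x = letter g (letter h x)"
    and "restriction (g \<otimes> h) x = restriction g (letter h x) \<otimes> restriction h x"
proof -
  interpret group G by (rule is_group)
  note h = restriction_letter[OF assms(2,3)]
  note g = restriction_letter[OF assms(1) h(2)]
  have "\<phi> (g \<otimes> h) (x # w)
      = letter g (letter h x) # \<phi> (restriction g (letter h x) \<otimes> restriction h x) w"
    if w: "w \<in> lists X" for w
  proof -
    have "\<phi> (restriction h x) w \<in> lists X"
      using element_image[OF h(1) w] by simp
    moreover have "x # w \<in> lists X"
      using w assms by simp
    ultimately show ?thesis
      using w assms g h by (simp add: composition_rule)
  qed
  then show "letter (g \<otimes> h) x = letter g (letter h x)"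
    "restriction (g \<otimes> h) x = restriction g (letter h x) \<otimes> restriction h x"
    using restriction_letter_unique[of "g \<otimes> h" x "restriction g (letter h x) \<otimes> restriction h x"]
      g h assms by auto
qed

lemma restriction_one:
  assumes "x \<in> X"
  shows "letter \<one> x = x" "restriction \<one> x = \<one>"
proof -
  interpret group G by (rule is_group)
  have "\<phi> \<one> w = w" if "w \<in> lists X" for w
    using id_eq_one that by (metis restrict_apply')
  then show "letter \<one> x = x" "restriction \<one> x = \<one>"
    using restriction_letter_unique[of \<one> x \<one> x] assms by auto
qed

section \<open>The left walk and its letter paths\<close>

lemma left_walk_Nil: "left_walk G [] = \<one>"
  by (simp add: left_walk_def)

lemma left_walk_snoc: "left_walk G (hs @ [h]) = h \<otimes> left_walk G hs"
  by (simp add: left_walk_def)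

lemma left_walk_closed: "set hs \<subseteq> carrier G \<Longrightarrow> left_walk G hs \<in> carrier G"
proof (induction hs rule: rev_induct)
  case Nil
  then show ?case
    using is_group by (simp add: left_walk_Nil group.is_monoid monoid.one_closed)
next
  case (snoc h hs)
  then show ?case
    using is_group by (simp add: left_walk_snoc group.is_monoid monoid.m_closed)
qed

text \<open>The first increment ends up as the rightmost factor, which is what splits a path after
  its first step.\<close>

lemma left_walk_Cons:
  "set hs \<subseteq> carrier G \<Longrightarrow> h \<in> carrier G \<Longrightarrow> left_walk G (h # hs) = left_walk G hs \<otimes> h"
proof (induction hs rule: rev_induct)
  case Nil
  interpret group G by (rule is_group)
  show ?case
    using Nil left_walk_snoc[of "[]" h] by (simp add: left_walk_Nil)
next
  case (snoc g hs)
  interpret group G by (rule is_group)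
  have "left_walk G (h # hs @ [g]) = g \<otimes> (left_walk G hs \<otimes> h)"
    using snoc left_walk_snoc[of "h # hs" g] by simp
  then show ?case
    using snoc left_walk_closed[of hs] by (simp add: left_walk_snoc m_assoc)
qed

lemma set_take_subsetI: "set hs \<subseteq> A \<Longrightarrow> set (take k hs) \<subseteq> A"
  using set_take_subset[of k hs] by (rule subset_trans)

text \<open>Only the strictly intermediate letters are constrained to \<open>J\<close>; thus the same events serve for
  powers of a submatrix (endpoints in \<open>J\<close>) and for first returns (endpoints outside \<open>J\<close>).\<close>

definition paths :: "'x set \<Rightarrow> 'x \<Rightarrow> 'x \<Rightarrow> 'g list set" where
  "paths J x y = {hs. set hs \<subseteq> carrier G \<and> letter (left_walk G hs) x = y \<and>
     (\<forall>k. 1 \<le> k \<and> k < length hs \<longrightarrow> letter (left_walk G (take k hs)) x \<in> J)}"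

text \<open>The indices run from the start \<open>x\<close> to the end \<open>y\<close>, opposite to
  the target-first convention of \<open>mat_entry\<close> and \<open>mat_power\<close>.\<close>

definition path_prob :: "'g pmf \<Rightarrow> 'x set \<Rightarrow> nat \<Rightarrow> 'x \<Rightarrow> 'x \<Rightarrow> 'g \<Rightarrow> real" where
  "path_prob \<mu> J n x y h =
     measure_pmf.prob (replicate_pmf n \<mu>) {hs \<in> paths J x y. restriction (left_walk G hs) x = h}"

text \<open>For \<open>hs = []\<close> the right-hand side demands that the start lie in
  \<open>J\<close>, although a one-step path has no intermediate letter; the assumption on
  \<open>x\<close> reconciles the two.\<close>

lemma paths_snoc_iff:
  assumes "x \<in> J" "J \<subseteq> X"
  shows "hs @ [g] \<in> paths J x y \<longleftrightarrow>
    letter (left_walk G hs) x \<in> J \<and> hs \<in> paths J x (letter (left_walk G hs) x) \<and>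
    g \<in> carrier G \<and> letter g (letter (left_walk G hs) x) = y" (is "?L \<longleftrightarrow> ?R")
proof (cases "g \<in> carrier G \<and> set hs \<subseteq> carrier G")
  case True
  then have lw: "letter (left_walk G (hs @ [g])) x = letter g (letter (left_walk G hs) x)"
    using assms by (simp add: subset_iff[of J] left_walk_snoc restriction_mult left_walk_closed)
  have "(\<forall>k. 1 \<le> k \<and> k < length (hs @ [g]) \<longrightarrow> letter (left_walk G (take k (hs @ [g]))) x \<in> J)
    \<longleftrightarrow> letter (left_walk G hs) x \<in> J \<and>
        (\<forall>k. 1 \<le> k \<and> k < length hs \<longrightarrow> letter (left_walk G (take k hs)) x \<in> J)"
  proof (cases "hs = []")
    case True
    then show ?thesis
      using assms by (auto simp: left_walk_Nil restriction_one)
  next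
    case False
    then show ?thesis
      by (auto simp: less_Suc_eq Suc_le_eq)
  qed
  then show ?thesis
    using True lw by (auto simp: paths_def)
qed (auto simp: paths_def)

text \<open>With \<open>hs = []\<close> the letter \<open>letter g x\<close> would be the endpoint
  and so unconstrained. The start has to lie only in \<open>X\<close>, which admits paths that leave
  \<open>i\<close>.\<close>

lemma paths_Cons_iff:
  assumes "x \<in> X" "hs \<noteq> []"
  shows "g # hs \<in> paths J x y \<longleftrightarrow>
    g \<in> carrier G \<and> letter g x \<in> J \<and> hs \<in> paths J (letter g x) y"
proof (cases "g \<in> carrier G \<and> set hs \<subseteq> carrier G")
  case True
  have lw: "letter (left_walk G (g # take k hs)) x = letter (left_walk G (take k hs)) (letter g x)"
    for k
    using assms True
    by (simp add: left_walk_Cons restriction_mult left_walk_closed set_take_subsetI)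
  have "(\<forall>k. 1 \<le> k \<and> k < length (g # hs) \<longrightarrow> letter (left_walk G (take k (g # hs))) x \<in> J)
    \<longleftrightarrow> (\<forall>k. k < length hs \<longrightarrow> letter (left_walk G (take k hs)) (letter g x) \<in> J)"
  proof (intro iffI allI impI)
    fix k
    assume *: "\<forall>k. 1 \<le> k \<and> k < length (g # hs) \<longrightarrow> letter (left_walk G (take k (g # hs))) x \<in> J"
      and "k < length hs"
    then show "letter (left_walk G (take k hs)) (letter g x) \<in> J"
      using *[rule_format, of "Suc k"] lw by simp
  next
    fix k
    assume "\<forall>k. k < length hs \<longrightarrow> letter (left_walk G (take k hs)) (letter g x) \<in> J"
      and "1 \<le> k \<and> k < length (g # hs)"
    then show "letter (left_walk G (take k (g # hs))) x \<in> J"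
      using lw by (cases k) auto
  qed
  also have "\<dots> \<longleftrightarrow> letter g x \<in> J \<and> (\<forall>k. 1 \<le> k \<and> k < length hs \<longrightarrow>
      letter (left_walk G (take k hs)) (letter g x) \<in> J)"
  proof -
    have "letter (left_walk G (take 0 hs)) (letter g x) = letter g x"
      using assms True restriction_letter[of g x] by (simp add: left_walk_Nil restriction_one)
    then show ?thesis
      using assms(2) by (metis One_nat_def Suc_leI length_greater_0_conv neq0_conv)
  qed
  finally show ?thesis
    using True lw[of "length hs"] by (auto simp: paths_def)
qed (auto simp: paths_def)

section \<open>Matrix entries, powers and Schur terms as laws of restrictions along paths\<close>

lemma mat_entry_eq_prob:
  assumes "x \<in> X"
  shows "mat_entry G X \<phi> (pmf \<mu>) y x
    = (\<lambda>h. measure_pmf.prob \<mu> {g \<in> {g \<in> carrier G. letter g x = y}. restriction g x = h})"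
proof
  fix h
  have "{g \<in> carrier G. \<phi> g [x] = [y] \<and> restriction g x = h}
      = {g \<in> {g \<in> carrier G. letter g x = y}. restriction g x = h}"
    using assms by (auto simp: act_singleton)
  then show "mat_entry G X \<phi> (pmf \<mu>) y x h
      = measure_pmf.prob \<mu> {g \<in> {g \<in> carrier G. letter g x = y}. restriction g x = h}"
    unfolding mat_entry_def by (simp add: infsumI[OF pmf_has_sum_prob])
qed

lemma path_prob_snoc:
  assumes "x \<in> J" "J \<subseteq> X"
  shows "path_prob \<mu> J (Suc n) x y h
    = (\<Sum>z\<in>J. l1_conv G (mat_entry G X \<phi> (pmf \<mu>) y z) (path_prob \<mu> J n x z) h)"
proof -
  \<comment> \<open>\<open>?B\<close> leaves the end of the path open; that end is the state
    \<open>k\<close> of \<open>sum_l1_conv_prob\<close>.\<close>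
  let ?B = "{hs. hs \<in> paths J x (letter (left_walk G hs) x)}"
  have "(\<Sum>z\<in>J. l1_conv G (mat_entry G X \<phi> (pmf \<mu>) y z) (path_prob \<mu> J n x z) h)
      = (\<Sum>z\<in>J. l1_conv G
          (\<lambda>r. measure_pmf.prob \<mu> {g \<in> {g \<in> carrier G. letter g z = y}. restriction g z = r})
          (\<lambda>r. measure_pmf.prob (replicate_pmf n \<mu>)
                 {hs \<in> ?B. letter (left_walk G hs) x = z \<and> restriction (left_walk G hs) x = r}) h)"
  proof (rule sum.cong[OF refl])
    fix z assume "z \<in> J"
    then have "mat_entry G X \<phi> (pmf \<mu>) y z
        = (\<lambda>r. measure_pmf.prob \<mu> {g \<in> {g \<in> carrier G. letter g z = y}. restriction g z = r})"
      using assms by (intro mat_entry_eq_prob) auto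
    moreover have "path_prob \<mu> J n x z = (\<lambda>r. measure_pmf.prob (replicate_pmf n \<mu>)
        {hs \<in> ?B. letter (left_walk G hs) x = z \<and> restriction (left_walk G hs) x = r})"
      unfolding path_prob_def
      by (intro ext arg_cong[where f = "measure_pmf.prob _"]) (auto simp: paths_def)
    ultimately show "l1_conv G (mat_entry G X \<phi> (pmf \<mu>) y z) (path_prob \<mu> J n x z) h = l1_conv G
          (\<lambda>r. measure_pmf.prob \<mu> {g \<in> {g \<in> carrier G. letter g z = y}. restriction g z = r})
          (\<lambda>r. measure_pmf.prob (replicate_pmf n \<mu>)
                 {hs \<in> ?B. letter (left_walk G hs) x = z \<and> restriction (left_walk G hs) x = r}) h"
      by simp
  qed
  also have "\<dots> = measure_pmf.prob (pair_pmf \<mu> (replicate_pmf n \<mu>))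
      {(g, hs). hs \<in> ?B \<and> letter (left_walk G hs) x \<in> J \<and>
         g \<in> {g \<in> carrier G. letter g (letter (left_walk G hs) x) = y} \<and>
         restriction g (letter (left_walk G hs) x) \<otimes> restriction (left_walk G hs) x = h}"
    using assms finite_alphabet
    by (intro sum_l1_conv_prob)
       (auto simp: finite_subset paths_def restriction_letter left_walk_closed)
  also have "\<dots> = measure_pmf.prob (pair_pmf \<mu> (replicate_pmf n \<mu>))
      {(g, hs). hs @ [g] \<in> paths J x y \<and> restriction (left_walk G (hs @ [g])) x = h}"
  proof (rule arg_cong[where f = "measure_pmf.prob _"], rule Collect_cong, clarify)
    fix g hs
    have "restriction (left_walk G (hs @ [g])) x
        = restriction g (letter (left_walk G hs) x) \<otimes> restriction (left_walk G hs) x"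
      if "g \<in> carrier G" "hs \<in> ?B"
      using that assms
      by (auto simp: left_walk_snoc restriction_mult left_walk_closed paths_def)
    then show "hs \<in> ?B \<and> letter (left_walk G hs) x \<in> J \<and>
         g \<in> {g \<in> carrier G. letter g (letter (left_walk G hs) x) = y} \<and>
         restriction g (letter (left_walk G hs) x) \<otimes> restriction (left_walk G hs) x = h
       \<longleftrightarrow> hs @ [g] \<in> paths J x y \<and> restriction (left_walk G (hs @ [g])) x = h"
      using assms by (auto simp: paths_snoc_iff)
  qed
  also have "\<dots> = path_prob \<mu> J (Suc n) x y h"
    unfolding path_prob_def replicate_pmf_Suc_snoc measure_map_pmf
    by (rule arg_cong[where f = "measure_pmf.prob _"]) auto
  finally show ?thesis
    by simp
qed

lemma path_prob_Cons:
  assumes "x \<in> X" "J \<subseteq> X" "n > 0"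
  shows "path_prob \<mu> J (Suc n) x y h
    = (\<Sum>z\<in>J. l1_conv G (path_prob \<mu> J n z y) (mat_entry G X \<phi> (pmf \<mu>) z x) h)"
proof -
  have "(\<Sum>z\<in>J. l1_conv G (path_prob \<mu> J n z y) (mat_entry G X \<phi> (pmf \<mu>) z x) h)
      = (\<Sum>z\<in>J. l1_conv G
          (\<lambda>r. measure_pmf.prob (replicate_pmf n \<mu>)
                 {hs \<in> paths J z y. restriction (left_walk G hs) z = r})
          (\<lambda>r. measure_pmf.prob \<mu> {g \<in> carrier G. letter g x = z \<and> restriction g x = r}) h)"
    using assms by (simp add: path_prob_def[abs_def] mat_entry_eq_prob conj_assoc)
  also have "\<dots> = measure_pmf.prob (pair_pmf (replicate_pmf n \<mu>) \<mu>)
      {(hs, g). g \<in> carrier G \<and> letter g x \<in> J \<and> hs \<in> paths J (letter g x) y \<and>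
         restriction (left_walk G hs) (letter g x) \<otimes> restriction g x = h}"
    using assms finite_alphabet
    by (intro sum_l1_conv_prob)
       (auto simp: finite_subset paths_def restriction_letter left_walk_closed)
  also have "\<dots> = measure_pmf.prob (pair_pmf (replicate_pmf n \<mu>) \<mu>)
      {(hs, g). g # hs \<in> paths J x y \<and> restriction (left_walk G (g # hs)) x = h}"
  proof (rule prob_cong_set_pmf, clarify)
    fix hs g
    assume "(hs, g) \<in> set_pmf (pair_pmf (replicate_pmf n \<mu>) \<mu>)"
    then have hs: "hs \<noteq> []"
      using assms by (auto simp: set_replicate_pmf)
    have "restriction (left_walk G (g # hs)) x
        = restriction (left_walk G hs) (letter g x) \<otimes> restriction g x"
      if "g \<in> carrier G" "hs \<in> paths J (letter g x) y"
      using that assms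
      by (auto simp: left_walk_Cons restriction_mult left_walk_closed paths_def)
    then show "(hs, g) \<in> {(hs, g). g \<in> carrier G \<and> letter g x \<in> J \<and> hs \<in> paths J (letter g x) y \<and>
         restriction (left_walk G hs) (letter g x) \<otimes> restriction g x = h}
       \<longleftrightarrow> (hs, g) \<in> {(hs, g). g # hs \<in> paths J x y \<and> restriction (left_walk G (g # hs)) x = h}"
      using assms hs by (auto simp: paths_Cons_iff)
  qed
  also have "\<dots> = path_prob \<mu> J (Suc n) x y h"
    unfolding path_prob_def replicate_pmf_Suc_Cons measure_map_pmf
    by (rule arg_cong[where f = "measure_pmf.prob _"]) auto
  finally show ?thesis
    by simp
qed

lemma mat_power_eq_path_prob:
  assumes "J \<subseteq> X" "x \<in> J" "y \<in> J"
  shows "mat_power G J (mat_entry G X \<phi> (pmf \<mu>)) n y x = path_prob \<mu> J n x y"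
  using assms(3)
proof (induction n arbitrary: y)
  case 0
  \<comment> \<open>The empty path ends where it starts and has restriction \<one>, which matches
    the identity matrix.\<close>
  have "letter \<one> x = x" "restriction \<one> x = \<one>"
    using assms restriction_one by auto
  then show ?case
    by (auto simp: fun_eq_iff path_prob_def paths_def left_walk_Nil l1_one_def indicator_def)
next
  case (Suc n)
  then show ?case
    using assms by (simp add: fun_eq_iff[of "mat_power _ _ _ (Suc _) _ _"] mat_prod_def path_prob_snoc)
qed

text \<open>The power accounts for \<open>n\<close> steps within \<open>X - {i}\<close>. The row of
  \<open>i\<close> appends the step back to \<open>i\<close>, where only the start must lie in
  \<open>X - {i}\<close>; the column prepends the step out of \<open>i\<close>. This makes
  \<open>n + 2\<close> steps.\<close>

lemma schur_term_eq_path_prob: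
  assumes "i \<in> X"
  shows "schur_term G X \<phi> i (pmf \<mu>) n = path_prob \<mu> (X - {i}) (n + 2) i i"
proof -
  let ?J = "X - {i}" and ?M = "mat_entry G X \<phi> (pmf \<mu>)"
  have "mat_prod G ?J ?M (mat_power G ?J ?M n) i z = path_prob \<mu> ?J (Suc n) z i" if "z \<in> ?J" for z
    using that assms
    by (intro ext) (simp add: mat_prod_def path_prob_snoc mat_power_eq_path_prob)
  then show ?thesis
    using assms
    by (intro ext) (simp add: schur_term_def Let_def path_prob_Cons
        mat_prod_def[of G ?J "mat_prod G ?J ?M (mat_power G ?J ?M n)"])
qed

lemma path_prob_1:
  assumes "x \<in> X"
  shows "path_prob \<mu> J 1 x y = mat_entry G X \<phi> (pmf \<mu>) y x"
proof -
  interpret group G by (rule is_group)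
  have "left_walk G [g] = g" if "g \<in> carrier G" for g
    using that left_walk_snoc[of "[]" g] by (simp add: left_walk_Nil)
  then show ?thesis
    unfolding path_prob_def replicate_pmf_1 measure_map_pmf
    by (auto simp: fun_eq_iff mat_entry_eq_prob[OF assms] paths_def
        intro!: arg_cong[where f = "measure_pmf.prob _"])
qed

section \<open>Total masses and summability of the first-return laws\<close>

lemma path_prob_has_sum:
  assumes "x \<in> X"
  shows "(path_prob \<mu> J n x y has_sum measure_pmf.prob (replicate_pmf n \<mu>) (paths J x y)) (carrier G)"
proof -
  have "{hs \<in> paths J x y. restriction (left_walk G hs) x \<in> carrier G} = paths J x y"
    using assms by (auto simp: paths_def restriction_letter left_walk_closed)
  then show ?thesis
    using prob_fibres_has_sum[of "replicate_pmf n \<mu>" "paths J x y"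
        "\<lambda>hs. restriction (left_walk G hs) x" "carrier G"]
    by (simp add: path_prob_def[abs_def])
qed

lemma path_prob_outside:
  assumes "x \<in> X" "h \<notin> carrier G"
  shows "path_prob \<mu> J n x y h = 0"
proof -
  have "{hs \<in> paths J x y. restriction (left_walk G hs) x = h} = {}"
    using assms by (auto simp: paths_def restriction_letter left_walk_closed)
  then show ?thesis
    unfolding path_prob_def by (simp only: measure_empty)
qed

lemma return_prob_summable:
  assumes "i \<in> X" "set_pmf \<mu> \<subseteq> carrier G"
  shows "summable (\<lambda>n. measure_pmf.prob (replicate_pmf (Suc n) \<mu>) (paths (X - {i}) i i))"
proof -
  let ?Q = "\<lambda>hs. letter (left_walk G hs) i = i"
  have "measure_pmf.prob (replicate_pmf (Suc n) \<mu>) (paths (X - {i}) i i)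
      = measure_pmf.prob (replicate_pmf (Suc n) \<mu>)
          {xs. ?Q xs \<and> (\<forall>k. 1 \<le> k \<and> k \<le> n \<longrightarrow> \<not> ?Q (take k xs))}" for n
  \<comment> \<open>On the support every letter stays in \<open>X\<close>, so lying in
    \<open>X - {i}\<close> just means differing from \<open>i\<close>, and the paths become first
    passages of \<open>?Q\<close>.\<close>
  proof (rule prob_cong_set_pmf)
    fix hs assume "hs \<in> set_pmf (replicate_pmf (Suc n) \<mu>)"
    then have "set hs \<subseteq> carrier G" and "length hs = Suc n"
      using assms by (auto simp: set_replicate_pmf simp del: replicate_pmf.simps)
    moreover from this have "letter (left_walk G (take k hs)) i \<in> X" for k
      using assms by (intro restriction_letter left_walk_closed set_take_subsetI)
    ultimately show "hs \<in> paths (X - {i}) i i \<longleftrightarrow>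
        hs \<in> {xs. ?Q xs \<and> (\<forall>k. 1 \<le> k \<and> k \<le> n \<longrightarrow> \<not> ?Q (take k xs))}"
      by (auto simp: paths_def less_Suc_eq_le)
  qed
  then show ?thesis
    using first_passage_summable[of \<mu> ?Q] by simp
qed

lemma schur_term_l1_sums:
  assumes "i \<in> X" "set_pmf \<mu> \<subseteq> carrier G"
  shows "l1_sums G (schur_term G X \<phi> i (pmf \<mu>)) (\<lambda>g. \<Sum>n. path_prob \<mu> (X - {i}) (n + 2) i i g)"
proof -
  \<comment> \<open>The Schur terms start at return time 2, so the return series loses its first
    term.\<close>
  have "summable (\<lambda>n. measure_pmf.prob (replicate_pmf (n + 2) \<mu>) (paths (X - {i}) i i))"
    using return_prob_summable[OF assms] by (subst (asm) summable_Suc_iff[symmetric]) simp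
  then show ?thesis
    unfolding schur_term_eq_path_prob[OF assms(1), abs_def]
    using assms(1)
    by (intro nonneg_l1_sums[where t = "\<lambda>n. measure_pmf.prob (replicate_pmf (n + 2) \<mu>)
          (paths (X - {i}) i i)"] path_prob_has_sum path_prob_outside)
       (simp_all add: path_prob_def)
qed

lemma path_prob_summable:
  assumes "i \<in> X" "set_pmf \<mu> \<subseteq> carrier G"
  shows "summable (\<lambda>n. path_prob \<mu> (X - {i}) (Suc n) i i g)"
  by (rule summable_comparison_test'[OF return_prob_summable[OF assms], of 0])
     (auto simp: path_prob_def simp del: replicate_pmf.simps intro!: measure_pmf.finite_measure_mono)

section \<open>First hits of the stabilizer and the image distribution\<close>

lemma first_hit_prob_nonneg: "0 \<le> first_hit_prob G \<mu> H n h"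
  by (simp add: first_hit_prob_def)

text \<open>The walk is in \<open>H\<close> exactly when the letter is back at \<open>i\<close>, so
  first hits are first-return paths sorted by the value of the walk. Collecting the values with
  restriction \<open>g\<close> gives the law of the restriction.\<close>

lemma first_hit_prob_has_sum:
  assumes "i \<in> X" "set_pmf \<mu> \<subseteq> carrier G" "n > 0"
    and H: "H = stabilizer G \<phi> [i]"
  shows "(first_hit_prob G \<mu> H n has_sum path_prob \<mu> (X - {i}) n i i g)
           {h \<in> H. restriction h i = g}"
proof -
  have H_iff: "h \<in> H \<longleftrightarrow> h \<in> carrier G \<and> letter h i = i" for h
    using assms(1) by (auto simp: H stabilizer_def act_singleton)
  have hit: "first_hit_prob G \<mu> H n h
      = measure_pmf.prob (replicate_pmf n \<mu>) {hs \<in> paths (X - {i}) i i. left_walk G hs = h}"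
    if "h \<in> H" for h
    unfolding first_hit_prob_def
  proof (rule prob_cong_set_pmf)
    fix hs assume "hs \<in> set_pmf (replicate_pmf n \<mu>)"
    then have "set hs \<subseteq> carrier G" and "length hs = n"
      using assms by (auto simp: set_replicate_pmf)
    moreover from this have "left_walk G (take k hs) \<in> carrier G" for k
      by (intro left_walk_closed set_take_subsetI)
    moreover from this have "letter (left_walk G (take k hs)) i \<in> X" for k
      using assms by (intro restriction_letter)
    ultimately show "hs \<in> {hs. left_walk G hs = h \<and> h \<in> H \<and>
          (\<forall>k. 1 \<le> k \<and> k < n \<longrightarrow> left_walk G (take k hs) \<notin> H)} \<longleftrightarrow>
        hs \<in> {hs \<in> paths (X - {i}) i i. left_walk G hs = h}"
      using that by (auto simp: paths_def H_iff)
  qed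
  have "{hs \<in> paths (X - {i}) i i. left_walk G hs \<in> {h \<in> H. restriction h i = g}}
      = {hs \<in> paths (X - {i}) i i. restriction (left_walk G hs) i = g}"
    by (auto simp: paths_def H_iff left_walk_closed)
  then have "((\<lambda>h. measure_pmf.prob (replicate_pmf n \<mu>)
        {hs \<in> paths (X - {i}) i i. left_walk G hs = h}) has_sum path_prob \<mu> (X - {i}) n i i g)
      {h \<in> H. restriction h i = g}"
    using prob_fibres_has_sum[of "replicate_pmf n \<mu>" "paths (X - {i}) i i" "left_walk G"
        "{h \<in> H. restriction h i = g}"]
    by (simp add: path_prob_def)
  then show ?thesis
    by (rule has_sum_cong[THEN iffD1, rotated]) (simp add: hit)
qed

lemma image_hitting_distribution:
  assumes "i \<in> X" "set_pmf \<mu> \<subseteq> carrier G" and H: "H = stabilizer G \<phi> [i]"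
  shows "image_distribution (\<lambda>h. restriction h i) H (hitting_distribution G \<mu> H) g
    = (\<Sum>n. path_prob \<mu> (X - {i}) (Suc n) i i g)"
proof -
  let ?S = "{h \<in> H. restriction h i = g}" and ?p = "\<lambda>n. path_prob \<mu> (X - {i}) n i i g"
  have range_Suc: "range Suc = {1..}"
    by (metis One_nat_def atLeast_Suc_greaterThan greaterThan_0)
  have p: "(\<lambda>n. ?p (Suc n)) summable_on UNIV"
    using path_prob_summable[OF assms(1,2)]
    by (subst summable_on_UNIV_nonneg_real_iff) (simp_all add: path_prob_def)
  then have "?p summable_on {1..}"
    using summable_on_reindex[of Suc UNIV ?p] by (simp add: range_Suc o_def)
  \<comment> \<open>Nonnegative terms whose sums over \<open>?S\<close> are the summable
    \<open>?p n\<close>: this licenses exchanging the sum over times with the sum over the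
    fibre.\<close>
  then have "(\<lambda>(n, h). first_hit_prob G \<mu> H n h) summable_on ({1..} \<times> ?S)"
    by (intro summable_on_SigmaI[where g = ?p])
       (auto intro!: first_hit_prob_has_sum assms simp: first_hit_prob_nonneg)
  then have "image_distribution (\<lambda>h. restriction h i) H (hitting_distribution G \<mu> H) g
      = (\<Sum>\<^sub>\<infinity>n\<in>{1..}. \<Sum>\<^sub>\<infinity>h\<in>?S. first_hit_prob G \<mu> H n h)"
    unfolding image_distribution_def hitting_distribution_def
    by (rule infsum_swap_banach[symmetric])
  also have "\<dots> = (\<Sum>\<^sub>\<infinity>n\<in>{1..}. ?p n)"
    by (intro infsum_cong infsumI first_hit_prob_has_sum assms) auto
  also have "\<dots> = (\<Sum>\<^sub>\<infinity>n. ?p (Suc n))"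
    using infsum_reindex[of Suc UNIV ?p] by (simp add: range_Suc o_def)
  also have "\<dots> = (\<Sum>n. ?p (Suc n))"
    using p has_sum_infsum has_sum_imp_sums sums_unique by blast
  finally show ?thesis .
qed

end

theorem theorem7p1:
  fixes G :: "('g, 'm) monoid_scheme"
    and X :: "'x set"
    and \<phi> :: "'g \<Rightarrow> 'x list \<Rightarrow> 'x list"
    and \<mu> :: "'g pmf"
    and i :: 'x
    and H :: "'g set"
    and \<mu>\<^sub>H \<mu>\<^sub>i :: "'g \<Rightarrow> real"
  assumes "self_similar_group G X \<phi>"
    and "card X \<ge> 2"
    and "set_pmf \<mu> \<subseteq> carrier G"
    and "i \<in> X"
    and "H = stabilizer G \<phi> [i]"
    and "\<mu>\<^sub>H = hitting_distribution G \<mu> H"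
    and "\<mu>\<^sub>i = image_distribution (\<lambda>h. restr G X \<phi> h i) H \<mu>\<^sub>H"
  shows "l1_summable G (schur_term G X \<phi> i (pmf \<mu>)) \<and>
    \<mu>\<^sub>i = prob_schur_map G X \<phi> i (pmf \<mu>)"
proof
  interpret self_similar_group G X \<phi> by fact
  note sums = schur_term_l1_sums[OF assms(4,3)]
  show "l1_summable G (schur_term G X \<phi> i (pmf \<mu>))"
    using sums by (auto simp: l1_summable_def)
  show "\<mu>\<^sub>i = prob_schur_map G X \<phi> i (pmf \<mu>)"
  proof
    fix g
    have "\<mu>\<^sub>i g = (\<Sum>n. path_prob \<mu> (X - {i}) (Suc n) i i g)"
      using assms image_hitting_distribution by simp
    \<comment> \<open>Return at time 1 gives the diagonal entry; the remaining returns give the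
      value of the Schur series.\<close>
    also have "\<dots> = path_prob \<mu> (X - {i}) 1 i i g + (\<Sum>n. path_prob \<mu> (X - {i}) (n + 2) i i g)"
      using suminf_split_head[OF path_prob_summable[OF assms(4,3), of g]] by simp
    also have "\<dots> = prob_schur_map G X \<phi> i (pmf \<mu>) g"
      using assms(4) by (simp add: prob_schur_map_def l1_suminf_eq[OF sums] path_prob_1[unfolded One_nat_def])
    finally show "\<mu>\<^sub>i g = prob_schur_map G X \<phi> i (pmf \<mu>) g" .
  qed
qed

end
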